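(* Let $m\ge 3$ be an integer, and let $M(m,1)$ be the Mellin operator with $m_1=1$. Then $$M(m,1)=\frac{d}{dx}\circ\left(x\prod_{k=0}^{m-2}\big((m-1)\theta+mk-1\big)+m^m\frac{d^{m-1}}{dx^{m-1}}\right),$$ and this is the only nontrivial decomposition of $M(m,1)$ in the Weyl algebra of linear differential operators with polynomial coefficients (a decomposition being a way of writing the operator as a product of operators, trivial if it involves nonzero constants as factors, and decompositions being identified up to nonzero constant multiples of the factors).
   Context: Let $\theta=x\frac{d}{dx}$, and let $\circ$ denote composition, i.e. the product in the Weyl algebra $\mathbb{C}[x]\langle \frac{d}{dx}\rangle$. For integers $m>m_1>0$, the Mellin operator $M(m,m_1)$ (associated with the trinomial equation $y^m+xy^{m_1}-1=0$) is $$M(m,m_1)=\prod_{k=0}^{m_1-1}(m_1\theta+mk+1)\prod_{k=0}^{m-m_1-1}\big((m-m_1)\theta+mk-1\big)-(-1)^{m_1}m^m\frac{d^m}{dx^m}.$$ *)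

theory Defs
  imports Complex_Main "HOL-Computational_Algebra.Polynomial"
begin

text \<open>
  Differential operators are realised by their action on \<open>\<complex>[x]\<close>. This action is faithful in
  characteristic 0, so the product of the Weyl algebra is composition of functions and
  \<open>d/dx\<close> is \<^const>\<open>pderiv\<close>.
\<close>

type_synonym diff_op = "complex poly \<Rightarrow> complex poly"

definition weyl_algebra :: "diff_op set" where
  "weyl_algebra = {D. \<exists>(n::nat) (a :: nat \<Rightarrow> complex poly).
     D = (\<lambda>f. \<Sum>i\<le>n. a i * (pderiv ^^ i) f)}"

definition op_prod :: "diff_op list \<Rightarrow> diff_op" where
  "op_prod Ls = foldr (\<circ>) Ls id"

definition theta :: diff_op where
  "theta f = [:0, 1:] * pderiv f"

text \<open>The operator \<open>a\<theta> + b\<close> for complex numbers \<open>a\<close> and \<open>b\<close>.\<close>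

definition theta_affine :: "complex \<Rightarrow> complex \<Rightarrow> diff_op" where
  "theta_affine a b f = smult a (theta f) + smult b f"

definition mellin_operator :: "nat \<Rightarrow> nat \<Rightarrow> diff_op" where
  "mellin_operator m m1 f =
     (op_prod (map (\<lambda>k. theta_affine (of_nat m1) (of_nat m * of_nat k + 1)) [0..<m1])
      \<circ> op_prod (map (\<lambda>k. theta_affine (of_nat m - of_nat m1) (of_nat m * of_nat k - 1))
                  [0..<m - m1])) f
     - smult ((- 1) ^ m1 * of_nat m ^ m) ((pderiv ^^ m) f)"

definition mellin_cofactor :: "nat \<Rightarrow> diff_op" where
  "mellin_cofactor m f =
     [:0, 1:] * op_prod (map (\<lambda>k. theta_affine (of_nat m - 1) (of_nat m * of_nat k - 1))
                          [0..<m - 1]) f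
     + smult (of_nat m ^ m) ((pderiv ^^ (m - 1)) f)"

text \<open>
  A decomposition may have any number of factors. The one-factor expression \<open>D = D\<close> is not
  counted as a nontrivial decomposition.
\<close>

definition nontrivial_decomposition :: "diff_op \<Rightarrow> diff_op list \<Rightarrow> bool" where
  "nontrivial_decomposition D Ls \<longleftrightarrow>
     length Ls \<ge> 2 \<and> set Ls \<subseteq> weyl_algebra \<and> D = op_prod Ls \<and>
     (\<forall>L\<in>set Ls. \<not> (\<exists>c. c \<noteq> 0 \<and> L = smult c))"

definition same_decomposition :: "diff_op list \<Rightarrow> diff_op list \<Rightarrow> bool" where
  "same_decomposition Ls Ls' \<longleftrightarrow>
     list_all2 (\<lambda>A B. \<exists>c. c \<noteq> 0 \<and> A = smult c \<circ> B) Ls Ls'"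

end

theory Submission
  imports Defs "HOL-Computational_Algebra.Fundamental_Theorem_Algebra"
begin

text \<open>
  The Weyl algebra is graded by weight: an operator \<open>D\<close> acts on monomials by
  \<open>D x^n = \<Sum>\<^sub>w s\<^sub>w(n) x^(n + w)\<close>, where the \<open>s\<^sub>w\<close> are finitely many polynomials (the
  \<^emph>\<open>symbol\<close> of \<open>D\<close>), and \<open>s\<^sub>w(n) = 0\<close> whenever \<open>n + w < 0\<close>. Composition becomes the twisted
  convolution \<open>u\<^sub>e(z) = \<Sum>\<^sub>v s\<^bsub>e - v\<^esub>(z + v) t\<^sub>v(z)\<close>, so that questions about factors turn into
  questions about roots of polynomials. The Mellin operator has only two components: weight \<open>0\<close>
  with \<open>f(z) = (z + 1) \<Prod>\<^sub>k ((m - 1) z + m k - 1)\<close>, and weight \<open>-m\<close> with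
  \<open>g(z) = m^m z (z - 1) \<dots> (z - m + 1)\<close>.

  Let \<open>M = A B\<close>. The products of the highest and of the lowest components of \<open>A\<close> and \<open>B\<close> are
  the components \<open>f\<close> and \<open>g\<close> of \<open>M\<close>; everything in between cancels. Suppose that neither \<open>A\<close>
  nor \<open>B\<close> is homogeneous. Two roots of \<open>f\<close> never differ by one of \<open>1, \<dots>, m - 1\<close>. Hence, by
  induction on decreasing weight, the vanishing of the middle components forces a root of the
  highest component of \<open>B\<close> to be a root of every component of \<open>B\<close>
  (\<open>right_root_propagates\<close>), and likewise for \<open>A\<close> up to a shift (\<open>left_root_propagates\<close>).
  The root \<open>1 / (m - 1)\<close> of \<open>f\<close> comes from one of the two highest components, and then it, or its
  translate by \<open>m\<close>, is a root of \<open>g\<close>. But it is not an integer, and all roots of \<open>g\<close> are.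

  So one factor is homogeneous (\<open>mellin_factor_homogeneous\<close>). The component of a homogeneous right
  factor has no root, because \<open>f\<close> and \<open>g\<close> have no common root, and so it is a constant polynomial.
  The component of a homogeneous left factor can only have a root corresponding to the root \<open>-1\<close>
  of \<open>f\<close>, and this root is simple because the roots of \<open>g\<close> are. The conditions at \<open>n + w < 0\<close> on
  both factors then leave only constants, and \<open>d/dx\<close> times a constant on the left
  (\<open>mellin_two_factors\<close>). As \<open>d/dx\<close> can be cancelled on the left and
  the only units are constants, a decomposition with any number of factors reduces to this case.
\<close>

section \<open>Symbols of differential operators\<close>

text \<open>
  Integer exponents make the coefficient of \<open>x^(n + w)\<close> meaningful for negative \<open>n + w\<close>, where it is
  \<open>0\<close>; a single equation in \<open>has_symbol\<close> then covers both the action of an operator and the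
  vanishing of \<open>s\<^sub>w(n)\<close> for \<open>n + w < 0\<close>.
\<close>

definition icoeff :: "complex poly \<Rightarrow> int \<Rightarrow> complex" where
  "icoeff p k = (if k < 0 then 0 else coeff p (nat k))"

definition has_symbol :: "diff_op \<Rightarrow> (int \<Rightarrow> complex poly) \<Rightarrow> bool" where
  "has_symbol D s \<longleftrightarrow>
     (\<forall>p q. D (p + q) = D p + D q) \<and> (\<forall>c p. D (smult c p) = smult c (D p)) \<and>
     finite {w. s w \<noteq> 0} \<and>
     (\<forall>n w. icoeff (D (monom 1 n)) (int n + w) = poly (s w) (of_nat n))"

text \<open>
  The factor \<open>[:v, 1:]\<close> is the shift \<open>z \<mapsto> z + v\<close>: the left operator acts on \<open>x^(n + v)\<close> after the
  right one has raised the exponent by \<open>v\<close>.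
\<close>

definition symbol_prod ::
    "(int \<Rightarrow> complex poly) \<Rightarrow> (int \<Rightarrow> complex poly) \<Rightarrow> int \<Rightarrow> complex poly" where
  "symbol_prod s t e = (\<Sum>v | t v \<noteq> 0. pcompose (s (e - v)) [:of_int v, 1:] * t v)"

lemma icoeff_0 [simp]: "icoeff 0 k = 0"
  by (simp add: icoeff_def)

lemma icoeff_add: "icoeff (p + q) k = icoeff p k + icoeff q k"
  by (simp add: icoeff_def)

lemma icoeff_smult: "icoeff (smult c p) k = c * icoeff p k"
  by (simp add: icoeff_def)

lemma icoeff_sum: "icoeff (\<Sum>i\<in>A. f i) k = (\<Sum>i\<in>A. icoeff (f i) k)"
  by (simp add: icoeff_def coeff_sum)

lemma icoeff_monom: "icoeff (monom c n) k = (if k = int n then c else 0)"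
  by (auto simp: icoeff_def)

lemma icoeff_eqI:
  assumes "\<And>k. icoeff p k = icoeff q k"
  shows "p = q"
proof (rule poly_eqI)
  fix n show "coeff p n = coeff q n"
    using assms[of "int n"] by (simp add: icoeff_def)
qed

lemma has_symbol_finite: "has_symbol D s \<Longrightarrow> finite {w. s w \<noteq> 0}"
  by (simp add: has_symbol_def)

lemma has_symbol_icoeff:
  "has_symbol D s \<Longrightarrow> icoeff (D (monom 1 n)) k = poly (s (k - int n)) (of_nat n)"
  by (metis has_symbol_def add.commute diff_add_cancel)

lemma has_symbol_neg:
  assumes "has_symbol D s" "int n + w < 0"
  shows "poly (s w) (of_nat n) = 0"
  using assms has_symbol_icoeff[OF assms(1), of n "int n + w"] by (simp add: icoeff_def)

lemma has_symbol_expand: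
  assumes "has_symbol D s"
  shows "D p = (\<Sum>k\<le>degree p. smult (coeff p k) (D (monom 1 k)))"
proof -
  have add: "D (p + q) = D p + D q" and sm: "D (smult c p) = smult c (D p)" for p q c
    using assms by (auto simp: has_symbol_def)
  have z: "D 0 = 0" using sm[of 0 0] by simp
  have "D (\<Sum>k\<in>A. g k) = (\<Sum>k\<in>A. D (g k))" if "finite A" for g and A :: "nat set"
    using that by (induction A) (auto simp: add z)
  from this[of "{..degree p}" "\<lambda>k. smult (coeff p k) (monom 1 k)"]
  have "D p = (\<Sum>k\<le>degree p. D (smult (coeff p k) (monom 1 k)))"
    by (simp add: smult_monom poly_as_sum_of_monoms)
  then show ?thesis by (simp only: sm)
qed

lemma has_symbol_op_unique:
  assumes "has_symbol D s" "has_symbol E s"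
  shows "D = E"
proof
  fix p
  have "D (monom 1 n) = E (monom 1 n)" for n
    by (rule icoeff_eqI) (simp add: has_symbol_icoeff[OF assms(1)] has_symbol_icoeff[OF assms(2)])
  then show "D p = E p"
    by (simp add: has_symbol_expand[OF assms(1), of p] has_symbol_expand[OF assms(2), of p])
qed

text \<open>
  Symbols are only tested at natural numbers; being polynomials, they are determined by these
  values, even by all but finitely many of them.
\<close>

lemma poly_eq_of_nat_large:
  fixes p q :: "complex poly"
  assumes "\<And>n. n \<ge> N \<Longrightarrow> poly p (of_nat n) = poly q (of_nat n)"
  shows "p = q"
proof (rule ccontr)
  assume "p \<noteq> q"
  then have "finite {x. poly (p - q) x = 0}" by (intro poly_roots_finite) simp
  moreover have "of_nat ` {N..} \<subseteq> {x. poly (p - q) x = 0}" using assms by auto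
  moreover have "infinite ((of_nat :: nat \<Rightarrow> complex) ` {N..})"
    by (subst finite_image_iff) (auto simp: infinite_Ici)
  ultimately show False using finite_subset by blast
qed

lemma has_symbol_unique:
  assumes "has_symbol D s" "has_symbol D t"
  shows "s = t"
proof
  fix w
  have "poly (s w) (of_nat n) = poly (t w) (of_nat n)" for n
    using assms by (metis has_symbol_def)
  then show "s w = t w" by (rule poly_eq_of_nat_large)
qed

lemma symbol_prod_nonzeroE:
  assumes "symbol_prod s t e \<noteq> 0"
  obtains v where "t v \<noteq> 0" "s (e - v) \<noteq> 0"
proof -
  obtain v where "v \<in> {v. t v \<noteq> 0}" "pcompose (s (e - v)) [:of_int v, 1:] * t v \<noteq> 0"
    using assms unfolding symbol_prod_def by (rule sum.not_neutral_contains_not_neutral)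
  then show ?thesis using that[of v] by (metis mem_Collect_eq mult_zero_left pcompose_0)
qed

text \<open>
  Expand \<open>E x^n\<close> into monomials, apply \<open>D\<close> to each, and collect exponents. Exponents \<open>n + v < 0\<close>
  do occur in the formal sum over \<open>v\<close>, but there the symbol of \<open>E\<close> vanishes.
\<close>

lemma has_symbol_comp:
  assumes D: "has_symbol D s" and E: "has_symbol E t"
  shows "has_symbol (D \<circ> E) (symbol_prod s t)"
proof -
  let ?V = "{v. t v \<noteq> 0}"
  have finV: "finite ?V" using E by (rule has_symbol_finite)
  have "{e. symbol_prod s t e \<noteq> 0} \<subseteq> (\<lambda>(w, v). w + v) ` ({w. s w \<noteq> 0} \<times> ?V)"
  proof
    fix e assume "e \<in> {e. symbol_prod s t e \<noteq> 0}"
    then obtain v where "t v \<noteq> 0" "s (e - v) \<noteq> 0"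
      using symbol_prod_nonzeroE by blast
    then have "(e - v, v) \<in> {w. s w \<noteq> 0} \<times> ?V" by auto
    then show "e \<in> (\<lambda>(w, v). w + v) ` ({w. s w \<noteq> 0} \<times> ?V)"
      by (intro image_eqI[where x = "(e - v, v)"]) auto
  qed
  then have fin: "finite {e. symbol_prod s t e \<noteq> 0}"
    by (rule finite_subset) (use finV has_symbol_finite[OF D] in auto)
  have "icoeff ((D \<circ> E) (monom 1 n)) (int n + e) = poly (symbol_prod s t e) (of_nat n)" for n e
  proof -
    define p where "p = E (monom 1 n)"
    have "icoeff (D p) (int n + e)
        = (\<Sum>k\<le>degree p. coeff p k * poly (s (int n + e - int k)) (of_nat k))"
      by (subst has_symbol_expand[OF D])
         (simp add: icoeff_sum icoeff_smult has_symbol_icoeff[OF D])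
    also have "\<dots> = (\<Sum>v\<in>?V. icoeff p (int n + v) * poly (s (e - v)) (of_int (int n + v)))"
    proof (rule sum.reindex_bij_witness_not_neutral
        [where S' = "{k. k \<le> degree p \<and> coeff p k = 0}" and T' = "{v\<in>?V. icoeff p (int n + v) = 0}"
           and i = "\<lambda>v. nat (int n + v)" and j = "\<lambda>k. int k - int n"])
      show "finite {k. k \<le> degree p \<and> coeff p k = 0}" by simp
      show "finite {v\<in>?V. icoeff p (int n + v) = 0}" using finV by simp
      fix k assume k: "k \<in> {..degree p} - {k. k \<le> degree p \<and> coeff p k = 0}"
      have "icoeff p (int k) = poly (t (int k - int n)) (of_nat n)"
        unfolding p_def by (rule has_symbol_icoeff[OF E])
      then show "int k - int n \<in> ?V - {v\<in>?V. icoeff p (int n + v) = 0}"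
        using k by (auto simp: icoeff_def)
    next
      fix k
      show "icoeff p (int n + (int k - int n)) * poly (s (e - (int k - int n)))
          (of_int (int n + (int k - int n))) = coeff p k * poly (s (int n + e - int k)) (of_nat k)"
        by (simp add: icoeff_def algebra_simps)
    qed (auto simp: icoeff_def le_degree split: if_splits)
    also have "\<dots> = (\<Sum>v\<in>?V. poly (t v) (of_nat n) * poly (s (e - v)) (of_int (int n + v)))"
      by (simp add: p_def has_symbol_icoeff[OF E])
    also have "\<dots> = poly (symbol_prod s t e) (of_nat n)"
      by (simp add: symbol_prod_def poly_sum poly_pcompose mult.commute add.commute)
    finally show ?thesis by (simp add: p_def)
  qed
  with fin show ?thesis using D E by (simp add: has_symbol_def)
qed

lemma has_symbol_add:
  assumes "has_symbol D s" "has_symbol E t"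
  shows "has_symbol (\<lambda>f. D f + E f) (\<lambda>w. s w + t w)"
proof -
  have "{w. s w + t w \<noteq> 0} \<subseteq> {w. s w \<noteq> 0} \<union> {w. t w \<noteq> 0}" by auto
  then have "finite {w. s w + t w \<noteq> 0}"
    using assms finite_subset by (fastforce simp: has_symbol_def)
  with assms show ?thesis by (auto simp: has_symbol_def icoeff_add smult_add_right)
qed

lemma has_symbol_smult: "has_symbol (smult c) (\<lambda>w. if w = 0 then [:c:] else 0)"
proof -
  have "finite {w::int. (if w = 0 then [:c:] else 0) \<noteq> 0}"
    by (rule finite_subset[of _ "{0}"]) auto
  then show ?thesis by (auto simp: has_symbol_def icoeff_smult icoeff_monom smult_add_right mult.commute)
qed

lemma has_symbol_mult: "\<exists>s. has_symbol (\<lambda>f. p * f) s"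
proof -
  define s where "s = (\<lambda>w. [:icoeff p w:])"
  have "{w. s w \<noteq> 0} \<subseteq> {0..int (degree p)}"
    by (auto simp: s_def icoeff_def split: if_splits) (metis le_degree nat_le_iff not_less)
  then have "finite {w. s w \<noteq> 0}" using finite_subset by blast
  moreover have "icoeff (p * monom 1 n) (int n + w) = poly (s w) (of_nat n)" for n w
    by (auto simp: s_def icoeff_def mult.commute[of p] coeff_monom_mult nat_diff_distrib nat_less_iff nat_add_distrib)
  ultimately have "has_symbol (\<lambda>f. p * f) s" by (simp add: has_symbol_def ring_distribs)
  then show ?thesis by blast
qed

lemma pderiv_monom_1: "pderiv (monom 1 n) = (monom (of_nat n) (n - 1) :: complex poly)"
  by (simp add: pderiv_monom)

lemma has_symbol_smult_pderiv:
  "has_symbol (smult c \<circ> pderiv) (\<lambda>w. if w = -1 then [:0, c:] else 0)"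
proof -
  have "finite {w::int. (if w = -1 then [:0, c:] else 0) \<noteq> 0}"
    by (rule finite_subset[of _ "{-1}"]) auto
  moreover have "icoeff (smult c (pderiv (monom 1 n))) (int n + w)
      = poly (if w = -1 then [:0, c:] else 0) (of_nat n)" for n w
    by (cases n) (auto simp: pderiv_monom_1 icoeff_smult icoeff_monom)
  ultimately show ?thesis by (auto simp: has_symbol_def pderiv_add pderiv_smult smult_add_right mult.commute)
qed

lemma has_symbol_pderiv: "has_symbol pderiv (\<lambda>w. if w = -1 then [:0, 1:] else 0)"
  using has_symbol_smult_pderiv[of 1] by (simp add: comp_def)

lemma has_symbol_pderiv_power: "\<exists>s. has_symbol (pderiv ^^ i) s"
proof (induction i)
  case 0
  have "(pderiv ^^ 0 :: diff_op) = smult 1" by auto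
  then show ?case using has_symbol_smult by metis
next
  case (Suc i)
  then show ?case using has_symbol_comp[OF has_symbol_pderiv] by (auto simp: comp_def)
qed

lemma weyl_has_symbol:
  assumes "D \<in> weyl_algebra"
  obtains s where "has_symbol D s"
proof -
  obtain n a where D: "D = (\<lambda>f. \<Sum>i\<le>n. a i * (pderiv ^^ i) f)"
    using assms by (auto simp: weyl_algebra_def)
  have mono: "\<exists>s. has_symbol (\<lambda>f. a i * (pderiv ^^ i) f) s" for i :: nat
    using has_symbol_mult[of "a i"] has_symbol_pderiv_power[of i] has_symbol_comp
    by (fastforce simp: comp_def)
  have "\<exists>s. has_symbol (\<lambda>f. \<Sum>i\<le>n. a i * (pderiv ^^ i) f) s" for n
  proof (induction n)
    case 0 show ?case using mono[of 0] by simp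
  next
    case (Suc n) then show ?case using mono[of "Suc n"] has_symbol_add by fastforce
  qed
  then show ?thesis using that D by blast
qed

lemma op_prod_has_symbol:
  assumes "set Ls \<subseteq> weyl_algebra"
  obtains s where "has_symbol (op_prod Ls) s"
proof -
  have "\<exists>s. has_symbol (op_prod Ls) s" using assms
  proof (induction Ls)
    case Nil
    have "op_prod [] = smult 1" by (auto simp: op_prod_def)
    then show ?case using has_symbol_smult by metis
  next
    case (Cons L Ls)
    then obtain s t where "has_symbol L s" "has_symbol (op_prod Ls) t"
      using weyl_has_symbol by (metis insert_subset list.simps(15))
    from has_symbol_comp[OF this] show ?case by (auto simp: op_prod_def comp_def)
  qed
  then show ?thesis using that by blast
qed

section \<open>Extreme components of a product\<close>

definition extremes :: "(int \<Rightarrow> complex poly) \<Rightarrow> int \<Rightarrow> int \<Rightarrow> bool" where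
  "extremes s l h \<longleftrightarrow> s l \<noteq> 0 \<and> s h \<noteq> 0 \<and> (\<forall>w. s w \<noteq> 0 \<longrightarrow> l \<le> w \<and> w \<le> h)"

lemma extremes_exist:
  assumes "finite {w. s w \<noteq> 0}" "s w0 \<noteq> 0"
  obtains l h where "extremes s l h"
proof
  let ?S = "{w. s w \<noteq> 0}"
  have "?S \<noteq> {}" using assms(2) by auto
  then show "extremes s (Min ?S) (Max ?S)"
    using Min_in[OF assms(1)] Max_in[OF assms(1)] Min_le[OF assms(1)] Max_ge[OF assms(1)]
    by (auto simp: extremes_def)
qed

lemma poly_symbol_prod:
  "poly (symbol_prod s t e) z
     = (\<Sum>v | t v \<noteq> 0. poly (s (e - v)) (z + of_int v) * poly (t v) z)"
  by (simp add: symbol_prod_def poly_sum poly_pcompose add.commute)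

lemma poly_symbol_prod_single:
  assumes "finite {w. t w \<noteq> 0}"
    and "\<And>v. v \<noteq> v0 \<Longrightarrow> poly (s (e - v)) (z + of_int v) * poly (t v) z = 0"
  shows "poly (symbol_prod s t e) z = poly (s (e - v0)) (z + of_int v0) * poly (t v0) z"
proof -
  have "poly (symbol_prod s t e) z = (\<Sum>v\<in>{v. t v \<noteq> 0}.
      if v = v0 then poly (s (e - v0)) (z + of_int v0) * poly (t v0) z else 0)"
    unfolding poly_symbol_prod using assms(2) by (intro sum.cong) auto
  also have "\<dots> = poly (s (e - v0)) (z + of_int v0) * poly (t v0) z"
    using assms(1) by (cases "t v0 = 0") simp_all
  finally show ?thesis .
qed

lemma symbol_prod_top:
  assumes "finite {w. t w \<noteq> 0}" "extremes s l h" "extremes t l' h'"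
  shows "poly (symbol_prod s t (h + h')) z = poly (s h) (z + of_int h') * poly (t h') z"
proof -
  have "s (h + h' - v) = 0 \<or> t v = 0" if "v \<noteq> h'" for v
  proof (cases "v < h'")
    case True
    then have "\<not> h + h' - v \<le> h" by simp
    then show ?thesis using assms(2) by (auto simp: extremes_def)
  next
    case False
    then show ?thesis using assms(3) that by (force simp: extremes_def)
  qed
  then show ?thesis
    using poly_symbol_prod_single[OF assms(1), of h' s "h + h'" z] by fastforce
qed

lemma symbol_prod_bottom:
  assumes "finite {w. t w \<noteq> 0}" "extremes s l h" "extremes t l' h'"
  shows "poly (symbol_prod s t (l + l')) z = poly (s l) (z + of_int l') * poly (t l') z"
proof -
  have "s (l + l' - v) = 0 \<or> t v = 0" if "v \<noteq> l'" for v
  proof (cases "v > l'")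
    case True
    then have "\<not> l + l' - v \<ge> l" by simp
    then show ?thesis using assms(2) by (auto simp: extremes_def)
  next
    case False
    then show ?thesis using assms(3) that by (force simp: extremes_def)
  qed
  then show ?thesis
    using poly_symbol_prod_single[OF assms(1), of l' s "l + l'" z] by fastforce
qed

lemma shifted_product_nonzero:
  fixes p q :: "complex poly"
  assumes "p \<noteq> 0" "q \<noteq> 0"
  obtains z where "poly p (z + c) * poly q z \<noteq> 0"
proof -
  have "pcompose p [:c, 1:] \<noteq> 0" using assms(1) by (simp add: pcompose_eq_0_iff)
  then have "pcompose p [:c, 1:] * q \<noteq> 0" using assms(2) by simp
  then obtain z where "poly (pcompose p [:c, 1:] * q) z \<noteq> 0"
    using poly_all_0_iff_0 by blast
  then show ?thesis using that[of z] by (simp add: poly_pcompose add.commute)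
qed

text \<open>
  Polynomials over \<open>\<complex>\<close> form a domain, so neither the product of the highest nor that of the lowest
  components can vanish.
\<close>

lemma extremes_symbol_prod:
  assumes "finite {w. t w \<noteq> 0}" "extremes s l h" "extremes t l' h'"
  shows "extremes (symbol_prod s t) (l + l') (h + h')"
proof -
  have "symbol_prod s t (h + h') \<noteq> 0" "symbol_prod s t (l + l') \<noteq> 0"
    using shifted_product_nonzero[of "s h" "t h'" "of_int h'"] symbol_prod_top[OF assms]
      shifted_product_nonzero[of "s l" "t l'" "of_int l'"] symbol_prod_bottom[OF assms]
      assms(2,3) unfolding extremes_def by (metis poly_0)+
  moreover have "l + l' \<le> e \<and> e \<le> h + h'" if nz: "symbol_prod s t e \<noteq> 0" for e
  proof -
    obtain v where "t v \<noteq> 0" "s (e - v) \<noteq> 0"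
      using symbol_prod_nonzeroE[OF nz] by blast
    then have "l' \<le> v" "v \<le> h'" "l \<le> e - v" "e - v \<le> h"
      using assms(2,3) by (auto simp: extremes_def)
    then show ?thesis by linarith
  qed
  ultimately show ?thesis by (simp add: extremes_def)
qed

section \<open>Units and cancellation\<close>

lemma no_root_imp_constant:
  fixes p :: "complex poly"
  assumes "\<And>z. poly p z \<noteq> 0"
  obtains c where "c \<noteq> 0" "p = [:c:]"
proof -
  have "constant (poly p)" using assms fundamental_theorem_of_algebra by blast
  then have "degree p = 0" by (simp add: constant_degree)
  then obtain c where "p = [:c:]" by (rule degree_eq_zeroE)
  then show ?thesis using that assms by auto
qed

text \<open>
  Applied to the polynomial \<open>1\<close>, a component of negative weight gives \<open>0\<close>.
\<close>

lemma has_symbol_nonneg_weight: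
  assumes "has_symbol D s" "poly (s w) 0 \<noteq> 0"
  shows "w \<ge> 0"
  using has_symbol_neg[OF assms(1), of 0 w] assms(2) by fastforce

lemma homogeneous_imp_smult:
  assumes "has_symbol D s" "extremes s 0 0" "s 0 = [:c:]"
  shows "D = smult c"
proof (rule has_symbol_op_unique[OF assms(1)])
  have "s = (\<lambda>w. if w = 0 then [:c:] else 0)"
    using assms(2,3) by (fastforce simp: extremes_def fun_eq_iff)
  then show "has_symbol (smult c) s" using has_symbol_smult by simp
qed

text \<open>
  The highest and the lowest components of the two factors multiply to the nonzero constant \<open>c\<close>.
  The lowest ones therefore do not vanish at \<open>0\<close>, so all weights are nonnegative; as the highest
  weights add up to \<open>0\<close>, all weights are \<open>0\<close>.
\<close>

lemma factor_of_unit: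
  assumes A: "has_symbol A s" and B: "has_symbol B t" and AB: "A \<circ> B = smult c" and c: "c \<noteq> 0"
  shows "\<exists>a. a \<noteq> 0 \<and> A = smult a" "\<exists>b. b \<noteq> 0 \<and> B = smult b"
proof -
  have fs: "finite {w. s w \<noteq> 0}" and ft: "finite {w. t w \<noteq> 0}"
    using A B by (auto dest: has_symbol_finite)
  have U: "symbol_prod s t = (\<lambda>w. if w = 0 then [:c:] else 0)"
    using has_symbol_unique[OF has_symbol_comp[OF A B]] has_symbol_smult AB by metis
  have "symbol_prod s t 0 \<noteq> 0" using U c by simp
  then obtain v where "t v \<noteq> 0" "s (0 - v) \<noteq> 0" by (rule symbol_prod_nonzeroE)
  then obtain l h l' h' where es: "extremes s l h" and et: "extremes t l' h'"
    using extremes_exist[OF fs] extremes_exist[OF ft] by metis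
  have "extremes (symbol_prod s t) (l + l') (h + h')"
    by (rule extremes_symbol_prod[OF ft es et])
  then have sums: "l + l' = 0" "h + h' = 0"
    unfolding U by (auto simp: extremes_def split: if_splits)
  have prod: "poly (s l) (z + of_int l') * poly (t l') z = c" for z
    using symbol_prod_bottom[OF ft es et, of z] sums by (simp add: U)
  have nz: "poly (t l') z \<noteq> 0" for z using prod[of z] c by auto
  have nz': "poly (s l) z \<noteq> 0" for z using prod[of "z - of_int l'"] c by auto
  have "l \<ge> 0" "l' \<ge> 0"
    using has_symbol_nonneg_weight[OF A] has_symbol_nonneg_weight[OF B] nz nz' by auto
  moreover have "l \<le> h" "l' \<le> h'" using es et by (auto simp: extremes_def)
  ultimately have "l = 0" "h = 0" "l' = 0" "h' = 0" using sums by linarith+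
  then show "\<exists>a. a \<noteq> 0 \<and> A = smult a" "\<exists>b. b \<noteq> 0 \<and> B = smult b"
    using no_root_imp_constant[OF nz'] no_root_imp_constant[OF nz]
      homogeneous_imp_smult[OF A] homogeneous_imp_smult[OF B] es et by metis+
qed

text \<open>
  If \<open>X - Y\<close> has only constants as values, then each component of its symbol vanishes at all large
  natural numbers.
\<close>

lemma pderiv_left_cancel:
  assumes X: "has_symbol X s" and Y: "has_symbol Y t" and eq: "pderiv \<circ> X = pderiv \<circ> Y"
  shows "X = Y"
proof -
  have "s w = t w" for w
  proof (rule poly_eq_of_nat_large)
    fix n assume n: "n \<ge> nat (1 - w)"
    have "coeff (pderiv (X (monom 1 n))) (nat (int n + w) - 1)
        = coeff (pderiv (Y (monom 1 n))) (nat (int n + w) - 1)"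
      using eq by (metis comp_apply)
    moreover have pos: "Suc (nat (int n + w) - 1) = nat (int n + w)" "int n + w > 0" using n by auto
    moreover have "of_nat (nat (int n + w)) \<noteq> (0::complex)" using pos by (simp only: of_nat_eq_0_iff)
    ultimately have "icoeff (X (monom 1 n)) (int n + w) = icoeff (Y (monom 1 n)) (int n + w)"
      by (simp add: coeff_pderiv icoeff_def del: of_nat_Suc of_nat_nat)
    then show "poly (s w) (of_nat n) = poly (t w) (of_nat n)"
      by (simp add: has_symbol_icoeff[OF X] has_symbol_icoeff[OF Y])
  qed
  then have "s = t" by auto
  then show ?thesis using X Y has_symbol_op_unique by blast
qed

section \<open>Propagation of roots\<close>

text \<open>
  In the component of weight \<open>-k\<close> of the product, evaluated at \<open>\<rho>\<close>, all terms except
  \<open>s\<^sub>h(\<rho> + h' - k) t\<^bsub>h' - k\<^esub>(\<rho>)\<close> vanish, by the induction hypothesis or because a weight exceeds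
  its maximum. The first factor divides the value at \<open>\<rho> - k\<close> of the component of weight \<open>0\<close>, which
  is nonzero.
\<close>

lemma right_root_propagates:
  assumes fin: "finite {w. t w \<noteq> 0}" and es: "extremes s l h" and et: "extremes t l' h'"
    and sum: "h + h' = 0"
    and gap: "\<And>j. 0 < j \<Longrightarrow> j < m \<Longrightarrow> symbol_prod s t (- int j) = 0"
    and root: "poly (t h') \<rho> = 0"
    and nonroot: "\<And>j. 0 < j \<Longrightarrow> j < m \<Longrightarrow> poly (symbol_prod s t 0) (\<rho> - of_nat j) \<noteq> 0"
  shows "k < m \<Longrightarrow> poly (t (h' - int k)) \<rho> = 0"
proof (induction k rule: less_induct)
  case (less k)
  show ?case
  proof (cases "k = 0")
    case True then show ?thesis using root by simp
  next
    case False
    then have k: "0 < k" "k < m" using less.prems by auto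
    have "poly (s (- int k - v)) (\<rho> + of_int v) * poly (t v) \<rho> = 0" if ne: "v \<noteq> h' - int k" for v
    proof -
      consider "v > h'" | "v \<le> h'" "v > h' - int k" | "v < h' - int k" using ne by linarith
      then show ?thesis
      proof cases
        case 1 then have "t v = 0" using et by (force simp: extremes_def)
        then show ?thesis by simp
      next
        case 2
        then show ?thesis using less.IH[of "nat (h' - v)"] k by auto
      next
        case 3 then have "- int k - v > h" using sum by linarith
        then have "s (- int k - v) = 0" using es by (force simp: extremes_def)
        then show ?thesis by simp
      qed
    qed
    from poly_symbol_prod_single[of t "h' - int k" s "- int k" \<rho>, OF fin this]
    have "poly (s (- int k - (h' - int k))) (\<rho> + of_int (h' - int k)) * poly (t (h' - int k)) \<rho> = 0"
      using gap[OF k] by simp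
    moreover have "- int k - (h' - int k) = h" using sum by simp
    moreover have "poly (s h) (\<rho> + of_int (h' - int k)) \<noteq> 0"
      using symbol_prod_top[OF fin es et, of "\<rho> - of_nat k"] nonroot[OF k] sum
      by (simp add: algebra_simps)
    ultimately show ?thesis by simp
  qed
qed

text \<open>
  This mirrors the propagation for right factors, with the exponent \<open>\<mu>\<close> on which all terms land
  kept fixed in place of the exponent from which they start. The component of weight \<open>w\<close> lands
  on \<open>\<mu>\<close> when it starts at \<open>\<mu> - w\<close>, which accounts for the arguments of \<open>s\<close>.
\<close>

lemma left_root_propagates:
  assumes fin: "finite {w. t w \<noteq> 0}" and es: "extremes s l h" and et: "extremes t l' h'"
    and sum: "h + h' = 0"
    and gap: "\<And>j. 0 < j \<Longrightarrow> j < m \<Longrightarrow> symbol_prod s t (- int j) = 0"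
    and root: "poly (s h) (\<mu> - of_int h) = 0"
    and nonroot: "\<And>j. 0 < j \<Longrightarrow> j < m \<Longrightarrow> poly (symbol_prod s t 0) (\<mu> + of_nat j) \<noteq> 0"
  shows "k < m \<Longrightarrow> poly (s (h - int k)) (\<mu> - of_int (h - int k)) = 0"
proof (induction k rule: less_induct)
  case (less k)
  show ?case
  proof (cases "k = 0")
    case True then show ?thesis using root by simp
  next
    case False
    then have k: "0 < k" "k < m" using less.prems by auto
    have "poly (s (- int k - v)) (\<mu> + of_nat k + of_int v) * poly (t v) (\<mu> + of_nat k) = 0"
      if ne: "v \<noteq> h'" for v
    proof -
      consider "v > h'" | "v < h'" "v \<ge> h' - int k" | "v < h' - int k" using ne by linarith
      then show ?thesis
      proof cases
        case 1 then have "t v = 0" using et by (force simp: extremes_def)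
        then show ?thesis by simp
      next
        case 2
        define j where "j = nat (h + int k + v)"
        have j: "j < k" "h - int j = - int k - v" using 2 sum by (auto simp: j_def)
        have "poly (s (- int k - v)) (\<mu> - of_int (- int k - v)) = 0"
          using less.IH[OF j(1)] j k by simp
        then show ?thesis by (simp add: algebra_simps)
      next
        case 3 then have "- int k - v > h" using sum by linarith
        then have "s (- int k - v) = 0" using es by (force simp: extremes_def)
        then show ?thesis by simp
      qed
    qed
    from poly_symbol_prod_single[of t h' s "- int k" "\<mu> + of_nat k", OF fin this]
    have "poly (s (- int k - h')) (\<mu> + of_nat k + of_int h') * poly (t h') (\<mu> + of_nat k) = 0"
      using gap[OF k] by simp
    moreover have "poly (t h') (\<mu> + of_nat k) \<noteq> 0"
      using symbol_prod_top[OF fin es et, of "\<mu> + of_nat k"] nonroot[OF k] sum by auto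
    moreover have "- int k - h' = h - int k" using sum by simp
    moreover have "\<mu> + of_nat k + of_int h' = \<mu> - of_int (h - int k)"
      using sum by (simp add: eq_neg_iff_add_eq_0[symmetric])
    ultimately show ?thesis by simp
  qed
qed

section \<open>The symbol of the Mellin operator\<close>

definition mellin_top :: "nat \<Rightarrow> complex poly" where
  "mellin_top m = [:1, 1:] * (\<Prod>k<m - 1. [:of_nat m * of_nat k - 1, of_nat m - 1:])"

definition mellin_bottom :: "nat \<Rightarrow> complex poly" where
  "mellin_bottom m = smult (of_nat m ^ m) (\<Prod>i<m. [:- of_nat i, 1:])"

definition mellin_symbol :: "nat \<Rightarrow> int \<Rightarrow> complex poly" where
  "mellin_symbol m w = (if w = 0 then mellin_top m else if w = - int m then mellin_bottom m else 0)"

text \<open>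
  The root \<open>-1\<close> of the factor \<open>z + 1\<close> is also the root of the factor with \<open>k = 1\<close>.
\<close>

lemma mellin_top_root_iff:
  assumes "m \<ge> 3"
  shows "poly (mellin_top m) z = 0
     \<longleftrightarrow> (\<exists>k<m - 1. (of_nat m - 1) * z + of_nat m * of_nat k - 1 = 0)"
proof -
  have "poly (mellin_top m) z
      = (z + 1) * (\<Prod>k<m - 1. (of_nat m - 1) * z + of_nat m * of_nat k - 1)"
    unfolding mellin_top_def poly_mult poly_prod by (simp add: algebra_simps)
  then have "poly (mellin_top m) z = 0
     \<longleftrightarrow> z = - 1 \<or> (\<exists>k<m - 1. (of_nat m - 1) * z + of_nat m * of_nat k - 1 = 0)"
    by (auto simp: eq_neg_iff_add_eq_0)
  moreover have "1 < m - 1" using assms by simp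
  ultimately show ?thesis by (force simp: algebra_simps)
qed

lemma mellin_top_root_int:
  assumes "m \<ge> 3" "poly (mellin_top m) (of_int n) = 0"
  obtains k where "k < m - 1" "(int m - 1) * n + int m * int k - 1 = 0"
proof -
  obtain k where k: "k < m - 1" "(of_nat m - 1) * of_int n + of_nat m * of_nat k - (1::complex) = 0"
    using assms mellin_top_root_iff by blast
  have "of_int ((int m - 1) * n + int m * int k - 1) = (0::complex)" using k(2) by simp
  then have "(int m - 1) * n + int m * int k - 1 = 0" by (simp only: of_int_eq_0_iff)
  with k(1) show ?thesis by (rule that)
qed

text \<open>
  If two roots differ by \<open>j\<close>, then \<open>(m - 1) j\<close> is a multiple of \<open>m\<close>, and so is \<open>j\<close>.
\<close>

lemma mellin_top_root_diff:
  assumes m: "m \<ge> 3" and j: "0 < j" "j < m" and root: "poly (mellin_top m) z = 0"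
  shows "poly (mellin_top m) (z + of_nat j) \<noteq> 0" "poly (mellin_top m) (z - of_nat j) \<noteq> 0"
proof -
  have main: False
    if r: "poly (mellin_top m) z = 0" "poly (mellin_top m) (z + of_nat j) = 0" for z
  proof -
    obtain k k' where
      "(of_nat m - 1) * z + of_nat m * of_nat k - 1 = 0"
      "(of_nat m - 1) * (z + of_nat j) + of_nat m * of_nat k' - 1 = 0"
      using r mellin_top_root_iff[OF m] by metis
    moreover have "of_int ((int m - 1) * int j - int m * (int k - int k'))
        = ((of_nat m - 1) * (z + of_nat j) + of_nat m * of_nat k' - 1)
          - ((of_nat m - 1) * z + of_nat m * of_nat k - 1)"
      by (simp add: algebra_simps)
    ultimately have "of_int ((int m - 1) * int j - int m * (int k - int k')) = (0::complex)"
      by simp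
    then have "(int m - 1) * int j - int m * (int k - int k') = 0" by (simp only: of_int_eq_0_iff)
    then have "int j = int m * (int j - (int k - int k'))" by (simp add: algebra_simps)
    then have "int m dvd int j" by (metis dvd_triv_left)
    then show False using j zdvd_imp_le[of "int m" "int j"] by simp
  qed
  show "poly (mellin_top m) (z + of_nat j) \<noteq> 0" using main root by blast
  show "poly (mellin_top m) (z - of_nat j) \<noteq> 0" using main[of "z - of_nat j"] root by auto
qed

lemma mellin_top_nat:
  assumes "m \<ge> 3"
  shows "poly (mellin_top m) (of_nat n) \<noteq> 0"
proof
  assume "poly (mellin_top m) (of_nat n) = 0"
  then obtain k where k: "(int m - 1) * int n + int m * int k - 1 = 0"
    using mellin_top_root_int[OF assms, of "int n"] by auto
  have "(int m - 1) * int n \<ge> 2 * int n" "int m * int k \<ge> 3 * int k"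
    using assms by (intro mult_right_mono; simp)+
  then have "n = 0" "k = 0" using k by linarith+
  then show False using k by simp
qed

text \<open>
  A root \<open>-q\<close> satisfies \<open>q \<equiv> 1\<close> modulo \<open>m\<close>.
\<close>

lemma mellin_top_neg:
  assumes "m \<ge> 3" "1 < q" "q \<le> m"
  shows "poly (mellin_top m) (- of_nat q) \<noteq> 0"
proof
  assume "poly (mellin_top m) (- of_nat q) = 0"
  then obtain k where "(int m - 1) * (- int q) + int m * int k - 1 = 0"
    using mellin_top_root_int[OF assms(1), of "- int q"] by auto
  then have "int q - 1 = int m * (int q - int k)" by (simp add: algebra_simps)
  then have "int m dvd int q - 1" by (metis dvd_triv_left)
  then show False using assms zdvd_imp_le[of "int m" "int q - 1"] by simp
qed

lemma mellin_bottom_root_iff: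
  assumes "m > 0"
  shows "poly (mellin_bottom m) z = 0 \<longleftrightarrow> (\<exists>i<m. z = of_nat i)"
  using assms by (auto simp: mellin_bottom_def poly_prod)

lemma mellin_bottom_simple_roots:
  assumes m: "m > 0" and eq: "mellin_bottom m = [:- a, 1:] * q"
  shows "poly q a \<noteq> 0"
proof -
  have "poly (mellin_bottom m) a = 0" by (simp add: eq)
  then obtain i where i: "i < m" "a = of_nat i" using mellin_bottom_root_iff[OF m] by blast
  have "mellin_bottom m
      = [:- a, 1:] * smult (of_nat m ^ m) (\<Prod>i\<in>{..<m} - {i}. [:- of_nat i, 1:])"
    unfolding mellin_bottom_def using i by (subst prod.remove[of _ i]) auto
  then have "q = smult (of_nat m ^ m) (\<Prod>i\<in>{..<m} - {i}. [:- of_nat i, 1:])"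
    using eq by (metis mult_cancel_left pCons_eq_0_iff one_neq_zero)
  then show ?thesis using i m by (auto simp: poly_prod)
qed

lemma mellin_top_nonzero: "m \<ge> 3 \<Longrightarrow> mellin_top m \<noteq> 0"
  using mellin_top_nat[of m 0] by auto

lemma mellin_bottom_nonzero: "m \<ge> 3 \<Longrightarrow> mellin_bottom m \<noteq> 0"
  using mellin_bottom_root_iff[of m "of_nat m"] by auto

lemma extremes_mellin_symbol:
  assumes "m \<ge> 3"
  shows "extremes (mellin_symbol m) (- int m) 0"
  using assms mellin_top_nonzero[OF assms] mellin_bottom_nonzero[OF assms]
  by (auto simp: extremes_def mellin_symbol_def split: if_splits)

lemma extremes_unique:
  assumes "extremes s l h" "extremes s l' h'"
  shows "l = l' \<and> h = h'"
  using assms unfolding extremes_def by (meson order_antisym)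

section \<open>Two-factor decompositions\<close>

text \<open>
  Non-homogeneity of both factors bounds the range of weights of each of them by \<open>m - 1\<close>, since the
  ranges add up to \<open>m\<close>. Thus the propagation of roots reaches the lowest component.
\<close>

lemma mellin_factor_homogeneous:
  assumes m: "m \<ge> 3" and U: "symbol_prod s t = mellin_symbol m"
    and fin: "finite {w. t w \<noteq> 0}" and es: "extremes s l h" and et: "extremes t l' h'"
  shows "l = h \<or> l' = h'"
proof (rule ccontr)
  assume neq: "\<not> (l = h \<or> l' = h')"
  have "extremes (mellin_symbol m) (l + l') (h + h')"
    using extremes_symbol_prod[OF fin es et] U by simp
  then have sums: "l + l' = - int m" "h + h' = 0"
    using extremes_unique[OF _ extremes_mellin_symbol[OF m]] by auto
  have less: "l < h" "l' < h'" using neq es et by (auto simp: extremes_def)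
  have top: "poly (mellin_top m) z = poly (s h) (z + of_int h') * poly (t h') z" for z
    using symbol_prod_top[OF fin es et, of z] sums by (simp add: U mellin_symbol_def)
  have bot: "poly (mellin_bottom m) z = poly (s l) (z + of_int l') * poly (t l') z" for z
    using symbol_prod_bottom[OF fin es et, of z] sums m by (simp add: U mellin_symbol_def)
  have gap: "symbol_prod s t (- int j) = 0" if "0 < j" "j < m" for j
    using that by (simp add: U mellin_symbol_def)
  (* The root of the factor with k = 0. *)
  define \<rho> :: complex where "\<rho> = 1 / (of_nat m - 1)"
  have m1: "of_nat m - 1 \<noteq> (0::complex)" using m by auto
  have root: "poly (mellin_top m) \<rho> = 0"
    unfolding mellin_top_root_iff[OF m] using m m1 by (intro exI[of _ 0]) (simp add: \<rho>_def)
  have nonroot: "poly (symbol_prod s t 0) (\<rho> + of_nat j) \<noteq> 0"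
    "poly (symbol_prod s t 0) (\<rho> - of_nat j) \<noteq> 0" if "0 < j" "j < m" for j
    using mellin_top_root_diff[OF m that root] by (simp_all add: U mellin_symbol_def)
  have nonint: "\<rho> \<noteq> of_int i" for i
  proof
    assume "\<rho> = of_int i"
    then have "of_int ((int m - 1) * i) = (1::complex)" using m1 by (simp add: \<rho>_def field_simps)
    then have "(int m - 1) * i = 1" by (simp only: of_int_eq_1_iff)
    then show False using m by (simp add: zmult_eq_1_iff)
  qed
  have h': "h' = - h" using sums by simp
  have "poly (s h) (\<rho> - of_int h) * poly (t h') \<rho> = 0" using root top[of \<rho>] by (simp add: h')
  then consider "poly (t h') \<rho> = 0" | "poly (s h) (\<rho> - of_int h) = 0" by fastforce
  then show False
  proof cases
    case 1
    have "poly (t (h' - int (nat (h' - l')))) \<rho> = 0"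
      by (rule right_root_propagates[OF fin es et sums(2) gap 1 nonroot(2)]) (use sums less in auto)
    then have "poly (mellin_bottom m) \<rho> = 0" using less bot by simp
    then obtain i where "\<rho> = of_nat i" using mellin_bottom_root_iff[of m] m by auto
    then show False using nonint[of "int i"] by simp
  next
    case 2
    have "poly (s (h - int (nat (h - l)))) (\<rho> - of_int (h - int (nat (h - l)))) = 0"
      by (rule left_root_propagates[OF fin es et sums(2) gap 2 nonroot(1)]) (use sums less in auto)
    then have "poly (s l) (\<rho> - of_int l) = 0" using less by simp
    moreover have l': "l' = - int m - l" using sums(1) by simp
    ultimately have "poly (mellin_bottom m) (\<rho> + of_nat m) = 0"
      using bot[of "\<rho> + of_nat m"] by (simp add: l')
    then obtain i where "\<rho> + of_nat m = of_nat i" using mellin_bottom_root_iff[of m] m by auto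
    then have "\<rho> = of_int (int i - int m)" by (simp add: algebra_simps)
    then show False using nonint by blast
  qed
qed

text \<open>
  A root \<open>z\<close> of the only component \<open>s\<^sub>h\<close> gives a root \<open>z + h\<close> of the component of weight \<open>0\<close> of
  the Mellin operator and a root \<open>z + h + m\<close> of that of weight \<open>-m\<close>; this leaves \<open>z + h = -1\<close>.
\<close>

lemma mellin_homogeneous_left_factor:
  assumes m: "m \<ge> 3" and A: "has_symbol A s" and B: "has_symbol B t"
    and U: "symbol_prod s t = mellin_symbol m"
    and es: "extremes s h h" and et: "extremes t l' h'"
  shows "\<exists>c. c \<noteq> 0 \<and> (A = smult c \<or> A = smult c \<circ> pderiv)"
proof -
  have fin: "finite {w. t w \<noteq> 0}" using B by (rule has_symbol_finite)
  have "extremes (mellin_symbol m) (h + l') (h + h')"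
    using extremes_symbol_prod[OF fin es et] U by simp
  then have sums: "h + l' = - int m" "h + h' = 0"
    using extremes_unique[OF _ extremes_mellin_symbol[OF m]] by auto
  then have h': "h' = - h" and l': "l' = - int m - h" by auto
  have top: "poly (mellin_top m) z = poly (s h) (z - of_int h) * poly (t h') z" for z
    using symbol_prod_top[OF fin es et, of z] sums h' by (simp add: U mellin_symbol_def)
  have bot: "poly (mellin_bottom m) z = poly (s h) (z + of_int l') * poly (t l') z" for z
    using symbol_prod_bottom[OF fin es et, of z] sums m by (simp add: U mellin_symbol_def)
  define \<sigma> :: complex where "\<sigma> = - 1 - of_int h"
  have only_root: "z = \<sigma>" if z: "poly (s h) z = 0" for z
  proof -
    have r1: "poly (mellin_top m) (z + of_int h) = 0" using top[of "z + of_int h"] z by simp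
    have "poly (mellin_bottom m) (z + of_int h + of_nat m) = 0"
      using bot[of "z + of_int h + of_nat m"] z by (simp add: l')
    then obtain i where i: "i < m" "z + of_int h + of_nat m = of_nat i"
      using mellin_bottom_root_iff[of m] m by auto
    then have eq: "z + of_int h = - of_nat (m - i)" by (simp add: of_nat_diff algebra_simps)
    then have "\<not> 1 < m - i" using mellin_top_neg[OF m, of "m - i"] r1 by auto
    then have "m - i = 1" using i by simp
    then show ?thesis using eq by (simp add: \<sigma>_def algebra_simps)
  qed
  (* For h > 0 the right factor would lower weights too far: its highest component, of weight -h,
     kills 1, so the component of weight 0 of the product would vanish at 0. *)
  have h_le: "h \<le> 0"
  proof (rule ccontr)
    assume "\<not> h \<le> 0"
    then have "poly (t h') 0 = 0" using has_symbol_neg[OF B, of 0 h'] h' by simp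
    then show False using top[of 0] mellin_top_nat[OF m, of 0] by simp
  qed
  show ?thesis
  proof (cases "poly (s h) \<sigma> = 0")
    case False
    then obtain c where c: "c \<noteq> 0" "s h = [:c:]"
      using only_root no_root_imp_constant by metis
    have "h \<ge> 0" using has_symbol_nonneg_weight[OF A, of h] c by simp
    then have "h = 0" using h_le by simp
    then have "A = smult c" using homogeneous_imp_smult[OF A] es c by simp
    then show ?thesis using c by blast
  next
    case True
    then obtain q where q: "s h = [:- \<sigma>, 1:] * q" by (auto simp: poly_eq_0_iff_dvd)
    (* The root \<sigma> shifted back: a double root \<sigma> of the left factor, or a root a of the lowest
       component of the right one, would make a a double root of the falling factorial. *)
    define a where "a = \<sigma> - of_int l'"
    have "mellin_bottom m = [:- a, 1:] * (pcompose q [:of_int l', 1:] * t l')"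
    proof (rule poly_ext)
      show "poly (mellin_bottom m) z
          = poly ([:- a, 1:] * (pcompose q [:of_int l', 1:] * t l')) z" for z
        by (simp add: bot q poly_pcompose a_def algebra_simps)
    qed
    then have simple: "poly q \<sigma> * poly (t l') a \<noteq> 0"
      using mellin_bottom_simple_roots[of m a] m by (fastforce simp: poly_pcompose a_def)
    then have "poly q z \<noteq> 0" for z using only_root[of z] q by auto
    then obtain c where c: "c \<noteq> 0" "q = [:c:]" using no_root_imp_constant by metis
    have sh: "poly (s h) z = c * (z + 1 + of_int h)" for z
      by (simp add: q c \<sigma>_def algebra_simps)
    (* For h = 0 the left factor would be c (\<theta> + 1). The component of weight -m of the right
       factor kills x^(m - 1), and a = m - 1, contrary to the simplicity of the root. *)
    have "h \<noteq> 0"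
    proof
      assume "h = 0"
      then have "a = of_nat (m - 1)" using m by (simp add: a_def \<sigma>_def l' of_nat_diff)
      then have "poly (t l') a = 0"
        using has_symbol_neg[OF B, of "m - 1" l'] m \<open>h = 0\<close> l' by simp
      then show False using simple by simp
    qed
    moreover have "\<not> h < - 1"
    proof
      assume "h < - 1"
      then have "poly (s h) 0 = 0" using has_symbol_neg[OF A, of 0 h] by simp
      then have "of_int (1 + h) = (0::complex)" using sh[of 0] c by simp
      then show False using \<open>h < - 1\<close> by (simp only: of_int_eq_0_iff)
    qed
    ultimately have h: "h = - 1" using h_le by linarith
    have "s h = [:0, c:]" using q by (simp add: c \<sigma>_def h)
    then have "s = (\<lambda>w. if w = - 1 then [:0, c:] else 0)"
      using es h by (fastforce simp: extremes_def fun_eq_iff)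
    then have "A = smult c \<circ> pderiv"
      using has_symbol_op_unique[OF A] has_symbol_smult_pderiv by metis
    then show ?thesis using c by blast
  qed
qed

text \<open>
  A root of the only component of \<open>B\<close> would be a common root of both components of the Mellin
  operator. The remaining possibility, a multiple of \<open>x^h'\<close> with \<open>h' > 0\<close>, is excluded
  because the lowest component of \<open>A\<close> vanishes at \<open>0\<close>, which would give the component of weight
  \<open>-m\<close> the negative root \<open>-h'\<close>.
\<close>

lemma mellin_homogeneous_right_factor:
  assumes m: "m \<ge> 3" and A: "has_symbol A s" and B: "has_symbol B t"
    and U: "symbol_prod s t = mellin_symbol m"
    and es: "extremes s l h" and et: "extremes t h' h'"
  shows "\<exists>c. c \<noteq> 0 \<and> B = smult c"
proof -
  have fin: "finite {w. t w \<noteq> 0}" using B by (rule has_symbol_finite)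
  have "extremes (mellin_symbol m) (l + h') (h + h')"
    using extremes_symbol_prod[OF fin es et] U by simp
  then have sums: "l + h' = - int m" "h + h' = 0"
    using extremes_unique[OF _ extremes_mellin_symbol[OF m]] by auto
  have top: "poly (mellin_top m) z = poly (s h) (z + of_int h') * poly (t h') z" for z
    using symbol_prod_top[OF fin es et, of z] sums by (simp add: U mellin_symbol_def)
  have bot: "poly (mellin_bottom m) z = poly (s l) (z + of_int h') * poly (t h') z" for z
    using symbol_prod_bottom[OF fin es et, of z] sums m by (simp add: U mellin_symbol_def)
  have "poly (t h') z \<noteq> 0" for z
  proof
    assume "poly (t h') z = 0"
    then have "poly (mellin_top m) z = 0" "poly (mellin_bottom m) z = 0" by (simp_all add: top bot)
    then show False using mellin_bottom_root_iff[of m] mellin_top_nat[OF m] m by auto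
  qed
  then obtain c where c: "c \<noteq> 0" "t h' = [:c:]" using no_root_imp_constant by metis
  have "h' \<ge> 0" using has_symbol_nonneg_weight[OF B, of h'] c by simp
  moreover have "\<not> h' > 0"
  proof
    assume h': "h' > 0"
    then have "poly (s l) 0 = 0" using has_symbol_neg[OF A, of 0 l] sums by simp
    then have "poly (mellin_bottom m) (- of_int h') = 0" by (simp add: bot)
    then obtain i where "- of_int h' = (of_nat i :: complex)"
      using mellin_bottom_root_iff[of m] m by auto
    then have "of_int (h' + int i) = (0::complex)" by (simp add: neg_eq_iff_add_eq_0)
    then have "h' + int i = 0" by (simp only: of_int_eq_0_iff)
    then show False using h' by simp
  qed
  ultimately have "h' = 0" by simp
  then have "B = smult c" using homogeneous_imp_smult[OF B] et c by simp
  then show ?thesis using c by blast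
qed

lemma mellin_two_factors:
  assumes m: "m \<ge> 3" and M: "has_symbol M (mellin_symbol m)"
    and A: "has_symbol A s" and B: "has_symbol B t" and AB: "M = A \<circ> B"
  shows "(\<exists>c. c \<noteq> 0 \<and> A = smult c) \<or> (\<exists>c. c \<noteq> 0 \<and> B = smult c)
      \<or> (\<exists>c. c \<noteq> 0 \<and> A = smult c \<circ> pderiv)"
proof -
  have U: "symbol_prod s t = mellin_symbol m"
    using has_symbol_unique[OF has_symbol_comp[OF A B]] M AB by simp
  have fs: "finite {w. s w \<noteq> 0}" and ft: "finite {w. t w \<noteq> 0}"
    using A B by (auto dest: has_symbol_finite)
  have "symbol_prod s t 0 \<noteq> 0" using mellin_top_nonzero[OF m] by (simp add: U mellin_symbol_def)
  then obtain v where "t v \<noteq> 0" "s (0 - v) \<noteq> 0" by (rule symbol_prod_nonzeroE)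
  then obtain l h l' h' where es: "extremes s l h" and et: "extremes t l' h'"
    using extremes_exist[OF fs] extremes_exist[OF ft] by metis
  from mellin_factor_homogeneous[OF m U ft es et] show ?thesis
    using mellin_homogeneous_left_factor[OF m A B U _ et, of h]
      mellin_homogeneous_right_factor[OF m A B U es, of h'] es et by blast
qed

section \<open>The Mellin operator in the Weyl algebra\<close>

lemma weyl_algebraI:
  "D = (\<lambda>f. \<Sum>i\<le>n. a i * (pderiv ^^ i) f) \<Longrightarrow> D \<in> weyl_algebra"
  by (auto simp: weyl_algebra_def)

lemma weyl_add:
  assumes "D \<in> weyl_algebra" "E \<in> weyl_algebra"
  shows "(\<lambda>f. D f + E f) \<in> weyl_algebra"
proof -
  obtain n a k b where D: "D = (\<lambda>f. \<Sum>i\<le>n. a i * (pderiv ^^ i) f)"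
    and E: "E = (\<lambda>f. \<Sum>i\<le>k. b i * (pderiv ^^ i) f)"
    using assms by (auto simp: weyl_algebra_def)
  have pad: "(\<Sum>i\<le>n. a i * (pderiv ^^ i) f)
      = (\<Sum>i\<le>n + k. (if i \<le> n then a i else 0) * (pderiv ^^ i) f)"
    for n k f and a :: "nat \<Rightarrow> complex poly"
    by (rule sum.mono_neutral_cong_left) auto
  show ?thesis
    by (rule weyl_algebraI[of _ "\<lambda>i. (if i \<le> n then a i else 0) + (if i \<le> k then b i else 0)" "n + k"])
       (simp add: D E pad[where a = a and n = n and k = k] pad[where a = b and n = k and k = n] add.commute[of k n] ring_distribs sum.distrib)
qed

lemma weyl_mult:
  assumes "D \<in> weyl_algebra"
  shows "(\<lambda>f. p * D f) \<in> weyl_algebra"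
proof -
  obtain n a where D: "D = (\<lambda>f. \<Sum>i\<le>n. a i * (pderiv ^^ i) f)"
    using assms by (auto simp: weyl_algebra_def)
  show ?thesis
    by (rule weyl_algebraI[of _ "\<lambda>i. p * a i" n]) (simp add: D sum_distrib_left mult.assoc)
qed

lemma weyl_smult: "D \<in> weyl_algebra \<Longrightarrow> (\<lambda>f. smult c (D f)) \<in> weyl_algebra"
  using weyl_mult[of D "[:c:]"] by simp

lemma weyl_pderiv_power: "(pderiv ^^ k) \<in> weyl_algebra"
  by (rule weyl_algebraI[of _ "\<lambda>i. if i = k then 1 else 0" k])
     (simp add: if_distrib[of "\<lambda>x. x * _"] cong: if_cong)

lemma weyl_pderiv_comp:
  assumes "D \<in> weyl_algebra"
  shows "(\<lambda>f. pderiv (D f)) \<in> weyl_algebra"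
proof -
  obtain n a where D: "D = (\<lambda>f. \<Sum>i\<le>n. a i * (pderiv ^^ i) f)"
    using assms by (auto simp: weyl_algebra_def)
  have summand: "(\<lambda>f. pderiv (a i * (pderiv ^^ i) f)) \<in> weyl_algebra" for i :: nat
    using weyl_add[OF weyl_mult[OF weyl_pderiv_power[of "Suc i"], of "a i"]
        weyl_mult[OF weyl_pderiv_power[of i], of "pderiv (a i)"]]
    by (simp add: pderiv_mult mult.commute)
  have "(\<lambda>f. pderiv (\<Sum>i\<le>n. a i * (pderiv ^^ i) f)) \<in> weyl_algebra"
  proof (induction n)
    case 0 show ?case using summand[of 0] by simp
  next
    case (Suc n) then show ?case using weyl_add[OF _ summand[of "Suc n"]] by (simp add: pderiv_add)
  qed
  then show ?thesis by (simp add: D)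
qed

lemma weyl_theta_affine_prod:
  "op_prod (map (\<lambda>k. theta_affine a (b k)) ks) \<in> weyl_algebra"
proof (induction ks)
  case Nil
  show ?case using weyl_pderiv_power[of 0] by (simp add: op_prod_def id_def)
next
  case (Cons k ks)
  define D where "D = op_prod (map (\<lambda>k. theta_affine a (b k)) ks)"
  have "(\<lambda>f. smult a ([:0, 1:] * pderiv (D f)) + smult (b k) (D f)) \<in> weyl_algebra"
    using Cons.IH unfolding D_def[symmetric]
    by (intro weyl_add weyl_smult weyl_mult weyl_pderiv_comp)
  moreover have "op_prod (map (\<lambda>k. theta_affine a (b k)) (k # ks))
      = (\<lambda>f. smult a ([:0, 1:] * pderiv (D f)) + smult (b k) (D f))"
    by (simp add: op_prod_def D_def theta_affine_def theta_def fun_eq_iff)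
  ultimately show ?case by simp
qed

lemma weyl_mellin_cofactor: "mellin_cofactor m \<in> weyl_algebra"
proof -
  have "mellin_cofactor m = (\<lambda>f.
      [:0, 1:] * op_prod (map (\<lambda>k. theta_affine (of_nat m - 1) (of_nat m * of_nat k - 1)) [0..<m - 1]) f
      + smult (of_nat m ^ m) ((pderiv ^^ (m - 1)) f))"
    by (simp add: fun_eq_iff mellin_cofactor_def)
  also have "\<dots> \<in> weyl_algebra"
    by (intro weyl_add weyl_smult weyl_mult weyl_theta_affine_prod weyl_pderiv_power)
  finally show ?thesis .
qed

text \<open>
  The identity rests on \<open>\<theta> + 1 = d/dx \<circ> x\<close>.
\<close>

lemma mellin_factorization:
  assumes "m > 0"
  shows "mellin_operator m 1 = pderiv \<circ> mellin_cofactor m"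
proof
  fix f :: "complex poly"
  have pow: "pderiv ((pderiv ^^ (m - 1)) f) = (pderiv ^^ m) f"
    using assms by (cases m) auto
  show "mellin_operator m 1 f = (pderiv \<circ> mellin_cofactor m) f"
    by (simp add: mellin_operator_def mellin_cofactor_def op_prod_def[of "[_]"] theta_affine_def theta_def
        pderiv_add pderiv_smult pderiv_mult pderiv_pCons pow[unfolded One_nat_def])
qed

lemma theta_affine_prod_monom:
  "op_prod (map (\<lambda>k. theta_affine a (b k)) [0..<N]) (monom c n)
     = monom ((\<Prod>k<N. a * of_nat n + b k) * c) n"
proof (induction N arbitrary: c)
  case 0
  show ?case by (simp add: op_prod_def)
next
  case (Suc N)
  have snoc: "op_prod (xs @ [D]) f = op_prod xs (D f)" for xs D f
    by (induction xs) (simp_all add: op_prod_def)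
  have "theta (monom c n) = monom (of_nat n * c) n"
    by (cases n) (simp_all add: theta_def pderiv_monom flip: monom_Suc)
  then have "theta_affine a (b N) (monom c n) = monom ((a * of_nat n + b N) * c) n"
    by (simp add: theta_affine_def smult_monom add_monom ring_distribs mult.assoc)
  then show ?case by (simp add: snoc Suc.IH mult_ac)
qed

lemma pderiv_power_monom:
  "(pderiv ^^ i) (monom 1 n) = (monom (\<Prod>j<i. of_nat n - of_nat j) (n - i) :: complex poly)"
proof (induction i)
  case 0
  show ?case by simp
next
  case (Suc i)
  show ?case
  proof (cases "i \<le> n")
    case True
    then show ?thesis by (simp add: Suc.IH pderiv_monom of_nat_diff mult.commute)
  next
    case False
    then have "(\<Prod>j<i. of_nat n - of_nat j :: complex) = 0"
      by (intro prod_zero bexI[of _ n]) auto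
    then show ?thesis by (simp only: funpow.simps comp_apply Suc.IH prod.lessThan_Suc) simp
  qed
qed

text \<open>
  Linearity is inherited from the factorization, since the symbol only records values on monomials.
\<close>

lemma mellin_operator_has_symbol:
  assumes m: "m > 0"
  shows "has_symbol (mellin_operator m 1) (mellin_symbol m)"
proof -
  obtain s where "has_symbol (mellin_cofactor m) s"
    using weyl_has_symbol[OF weyl_mellin_cofactor] by blast
  from has_symbol_comp[OF has_symbol_pderiv this]
  obtain u where u: "has_symbol (mellin_operator m 1) u"
    using mellin_factorization[OF m] by metis
  have "{w. mellin_symbol m w \<noteq> 0} \<subseteq> {0, - int m}" by (auto simp: mellin_symbol_def)
  then have fin: "finite {w. mellin_symbol m w \<noteq> 0}" by (rule finite_subset) simp
  have "icoeff (mellin_operator m 1 (monom 1 n)) (int n + w) = poly (mellin_symbol m w) (of_nat n)" for n w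
  proof -
    have lead: "op_prod (map (\<lambda>k. theta_affine 1 (of_nat m * of_nat k + 1)) [0..<1])
        (op_prod (map (\<lambda>k. theta_affine (of_nat m - 1) (of_nat m * of_nat k - 1)) [0..<m - 1]) (monom 1 n))
        = monom (poly (mellin_top m) (of_nat n)) n"
      unfolding theta_affine_prod_monom
      by (simp add: mellin_top_def poly_prod algebra_simps)
    have tail: "smult (of_nat m ^ m) ((pderiv ^^ m) (monom 1 n))
        = monom (poly (mellin_bottom m) (of_nat n)) (n - m)"
      by (simp add: pderiv_power_monom smult_monom mellin_bottom_def poly_prod)
    have vanish: "poly (mellin_bottom m) (of_nat n) = 0" if "n < m"
      using that mellin_bottom_root_iff[of m "of_nat n"] by auto
    have "mellin_operator m 1 (monom 1 n)
        = monom (poly (mellin_top m) (of_nat n)) n + monom (poly (mellin_bottom m) (of_nat n)) (n - m)"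
      using lead tail by (simp add: mellin_operator_def)
    then show ?thesis
      using m vanish by (auto simp: mellin_symbol_def icoeff_add icoeff_monom)
  qed
  then show ?thesis using u fin by (simp add: has_symbol_def)
qed

section \<open>Decompositions with any number of factors\<close>

lemma factors_of_unit_product:
  assumes "set Ls \<subseteq> weyl_algebra" "c \<noteq> 0" "op_prod Ls = smult c" "L \<in> set Ls"
  shows "\<exists>a. a \<noteq> 0 \<and> L = smult a"
  using assms
proof (induction Ls arbitrary: c)
  case Nil
  then show ?case by simp
next
  case (Cons K Ls)
  obtain s t where K: "has_symbol K s" and R: "has_symbol (op_prod Ls) t"
    using Cons.prems(1) weyl_has_symbol[of K] op_prod_has_symbol[of Ls] by (metis insert_subset list.simps(15))
  have "K \<circ> op_prod Ls = smult c" using Cons.prems(3) by (simp add: op_prod_def comp_def)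
  note units = factor_of_unit[OF K R this Cons.prems(2)]
  show ?case
  proof (cases "L = K")
    case True then show ?thesis using units(1) by simp
  next
    case False then show ?thesis using units(2) Cons.IH Cons.prems by auto
  qed
qed

lemma smult_comp_cancel:
  assumes "c \<noteq> 0" "smult c \<circ> X = Y"
  shows "X = smult (inverse c) \<circ> (Y :: diff_op)"
proof
  fix f
  have "Y f = smult c (X f)" using assms(2) by auto
  then show "X f = (smult (inverse c) \<circ> Y) f" using assms(1) by simp
qed

theorem proposition5p4:
  fixes m :: nat
  assumes "m \<ge> 3"
  shows "mellin_operator m 1 = pderiv \<circ> mellin_cofactor m
    \<and> nontrivial_decomposition (mellin_operator m 1) [pderiv, mellin_cofactor m]
    \<and> (\<forall>Ls. nontrivial_decomposition (mellin_operator m 1) Ls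
          \<longrightarrow> same_decomposition Ls [pderiv, mellin_cofactor m])"
proof (intro conjI allI impI)
  note m = assms
  let ?unit = "\<lambda>L. \<exists>c. c \<noteq> 0 \<and> L = (smult c :: diff_op)"
  show fact: "mellin_operator m 1 = pderiv \<circ> mellin_cofactor m"
    using mellin_factorization m by simp
  obtain u where C: "has_symbol (mellin_cofactor m) u"
    using weyl_has_symbol[OF weyl_mellin_cofactor] by blast
  have pderiv_weyl: "pderiv \<in> weyl_algebra" using weyl_pderiv_power[of 1] by simp
  have pderiv_unit: "\<not> ?unit pderiv"
  proof
    assume "?unit pderiv"
    then obtain c where "c \<noteq> 0" "pderiv 1 = smult c (1 :: complex poly)" by metis
    then show False by simp
  qed
  have M: "has_symbol (mellin_operator m 1) (mellin_symbol m)"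
    using mellin_operator_has_symbol m by simp
  have C_unit: "\<not> ?unit (mellin_cofactor m)"
  proof
    assume "?unit (mellin_cofactor m)"
    then obtain c where "mellin_operator m 1 = pderiv \<circ> smult c" using fact by auto
    then have "mellin_operator m 1 (monom 1 0) = 0" by (simp add: pderiv_smult monom_0)
    then have "poly (mellin_symbol m 0) 0 = 0"
      using has_symbol_icoeff[OF M, of 0 0] by simp
    then show False using mellin_top_nat[OF m, of 0] by (simp add: mellin_symbol_def)
  qed
  show "nontrivial_decomposition (mellin_operator m 1) [pderiv, mellin_cofactor m]"
    using fact pderiv_weyl weyl_mellin_cofactor pderiv_unit C_unit
    by (simp add: nontrivial_decomposition_def op_prod_def)
  fix Ls assume Ls: "nontrivial_decomposition (mellin_operator m 1) Ls"
  then have weyl: "set Ls \<subseteq> weyl_algebra" and prod: "mellin_operator m 1 = op_prod Ls"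
    and nonunit: "\<And>L. L \<in> set Ls \<Longrightarrow> \<not> ?unit L" and len: "length Ls \<ge> 2"
    by (auto simp: nontrivial_decomposition_def)
  obtain A B R where Ls_eq: "Ls = A # B # R" using len by (metis Suc_le_length_iff numeral_2_eq_2)
  obtain a where a: "has_symbol A a" using weyl weyl_has_symbol[of A] by (auto simp: Ls_eq)
  obtain b where b: "has_symbol B b" using weyl weyl_has_symbol[of B] by (auto simp: Ls_eq)
  obtain r where r: "has_symbol (op_prod R) r" using weyl op_prod_has_symbol[of R] by (auto simp: Ls_eq)
  have assoc: "mellin_operator m 1 = A \<circ> (B \<circ> op_prod R)" "mellin_operator m 1 = (A \<circ> B) \<circ> op_prod R"
    using prod by (simp_all add: Ls_eq op_prod_def comp_assoc)
  have tail_unit: "\<not> ?unit (B \<circ> op_prod R)"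
    using factor_of_unit(1)[OF b r] nonunit[of B] by (auto simp: Ls_eq)
  then obtain c where c: "c \<noteq> 0" "A = smult c \<circ> pderiv"
    using mellin_two_factors[OF m M a has_symbol_comp[OF b r] assoc(1)] nonunit[of A]
    by (auto simp: Ls_eq)
  have pd_smult: "smult d \<circ> pderiv = pderiv \<circ> smult d" for d :: complex
    by (auto simp: fun_eq_iff pderiv_smult)
  have "R = []"
  proof (rule ccontr)
    assume "R \<noteq> []"
    then have "\<not> ?unit (op_prod R)"
      using factors_of_unit_product[of R _ "hd R"] weyl nonunit[of "hd R"] by (auto simp: Ls_eq)
    moreover have "\<not> ?unit (A \<circ> B)"
      using factor_of_unit(1)[OF a b] nonunit[of A] by (auto simp: Ls_eq)
    ultimately obtain d where d: "d \<noteq> 0" "A \<circ> B = smult d \<circ> pderiv"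
      using mellin_two_factors[OF m M has_symbol_comp[OF a b] r assoc(2)] by blast
    have "pderiv \<circ> B = smult (inverse c) \<circ> (smult d \<circ> pderiv)"
      using smult_comp_cancel[OF c(1), of "pderiv \<circ> B"] d(2) c(2) by (simp add: comp_assoc)
    also have "\<dots> = pderiv \<circ> smult (inverse c * d)"
      by (auto simp: fun_eq_iff pderiv_smult)
    finally have "B = smult (inverse c * d)"
      by (rule pderiv_left_cancel[OF b has_symbol_smult])
    moreover have "inverse c * d \<noteq> 0" using c d by simp
    ultimately show False using nonunit[of B] unfolding Ls_eq by (metis list.set_intros)
  qed
  then have "pderiv \<circ> mellin_cofactor m = A \<circ> B" using fact assoc by (simp add: op_prod_def)
  also have "\<dots> = pderiv \<circ> (smult c \<circ> B)" by (simp add: c(2) pd_smult comp_assoc)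
  finally have "mellin_cofactor m = smult c \<circ> B"
    by (rule pderiv_left_cancel[OF C has_symbol_comp[OF has_symbol_smult b]])
  then have "B = smult (inverse c) \<circ> mellin_cofactor m"
    using smult_comp_cancel[OF c(1)] by simp
  then show "same_decomposition Ls [pderiv, mellin_cofactor m]"
    using c \<open>R = []\<close> nonzero_imp_inverse_nonzero[OF c(1)]
    unfolding same_decomposition_def Ls_eq by (simp only: list_all2_Cons list.rel_inject) blast
qed

end
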